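(* Let $\beta$ be a $\mathbb{Z}^d$-action on an infinite compact metric space $(X,\rho)$ and let $V\in\mathsf{G}_{d-1}$. Then $V\in\mathsf{N}_{d-1}(\beta)$ if and only if there is an $H\in\mathsf{N}(\beta)$ with $\partial H=V$.
   Context: A $\mathbb{Z}^d$-action $\beta$ on $(X,\rho)$ is a homomorphism $\mathbf{n}\mapsto\beta^{\mathbf{n}}$ from $\mathbb{Z}^d$ to the group of homeomorphisms of $X$. For $F\subset\mathbb{R}^d$, put $\rho_\beta^F(x,y)=\sup\{\rho(\beta^{\mathbf{n}}x,\beta^{\mathbf{n}}y):\mathbf{n}\in F\cap\mathbb{Z}^d\}$ (and $0$ if $F\cap\mathbb{Z}^d=\emptyset$), and $F^t=\{\mathbf{x}\in\mathbb{R}^d:\operatorname{dist}(\mathbf{x},F)\le t\}$ (Euclidean distance). $F$ is expansive for $\beta$ if there are $\varepsilon>0$, $t>0$ such that $\rho_\beta^{F^t}(x,y)\le\varepsilon$ implies $x=y$; otherwise $F$ is nonexpansive for $\beta$. $\mathsf{G}_{d-1}$ is the set of $(d-1)$-dimensional linear subspaces of $\mathbb{R}^d$, and $\mathsf{N}_{d-1}(\beta)$ is the set of $V\in\mathsf{G}_{d-1}$ that are nonexpansive for $\beta$. $\mathsf{H}_d$ is the set of half-spaces $H_{\mathbf{v}}=\{\mathbf{x}\in\mathbb{R}^d:\mathbf{x}\cdot\mathbf{v}\le0\}$ with $\|\mathbf{v}\|=1$, and $\mathsf{N}(\beta)$ is the set of $H\in\mathsf{H}_d$ that are nonexpansive for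 $\beta$. $\partial H$ is the topological boundary of $H$. *)

theory Defs
  imports "HOL-Analysis.Analysis"
begin

text \<open>
  The lattice \<open>\<int>\<^sup>d\<close> is the type \<^typ>\<open>int ^ 'n\<close> with \<open>d = CARD('n) \<ge> 1\<close>, embedded in
  \<^typ>\<open>real ^ 'n\<close> by the following map.
\<close>

definition lattice_embed :: "int ^ 'n \<Rightarrow> real ^ 'n" where
  "lattice_embed n = (\<chi> i. real_of_int (n $ i))"

text \<open>
  The metric space is a subset \<open>X\<close> of a metric type, and the maps are only constrained on \<open>X\<close>.
  The identity law for \<open>\<beta> 0\<close> on \<open>X\<close> follows from additivity and bijectivity.
\<close>

definition Zd_action :: "'a::metric_space set \<Rightarrow> (int ^ 'n \<Rightarrow> 'a \<Rightarrow> 'a) \<Rightarrow> bool" where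
  "Zd_action X \<beta> \<longleftrightarrow>
     (\<forall>n. \<exists>g. homeomorphism X X (\<beta> n) g) \<and>
     (\<forall>m n. \<forall>x\<in>X. \<beta> (m + n) x = \<beta> m (\<beta> n x))"

text \<open>
  For \<open>x, y\<close> in a bounded invariant set, the distances below are bounded, so the real-valued
  supremum is the genuine one.
\<close>

definition rho_on ::
  "(int ^ 'n \<Rightarrow> 'a \<Rightarrow> 'a::metric_space) \<Rightarrow> (real ^ 'n) set \<Rightarrow> 'a \<Rightarrow> 'a \<Rightarrow> real" where
  "rho_on \<beta> F x y =
     (if {n. lattice_embed n \<in> F} = {} then 0
      else (SUP n \<in> {n. lattice_embed n \<in> F}. dist (\<beta> n x) (\<beta> n y)))"

text \<open>
  The library sets \<open>infdist x {} = 0\<close>; the first conjunct restores the convention that no point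
  is at finite distance from the empty set.
\<close>

definition thicken :: "(real ^ 'n) set \<Rightarrow> real \<Rightarrow> (real ^ 'n) set" where
  "thicken F t = {x. F \<noteq> {} \<and> infdist x F \<le> t}"

definition expansive_for ::
  "'a::metric_space set \<Rightarrow> (int ^ 'n \<Rightarrow> 'a \<Rightarrow> 'a) \<Rightarrow> (real ^ 'n) set \<Rightarrow> bool" where
  "expansive_for X \<beta> F \<longleftrightarrow>
     (\<exists>\<epsilon>>0. \<exists>t>0. \<forall>x\<in>X. \<forall>y\<in>X. rho_on \<beta> (thicken F t) x y \<le> \<epsilon> \<longrightarrow> x = y)"

definition hyperplanes :: "(real ^ 'n) set set" where
  "hyperplanes = {V. subspace V \<and> dim V = CARD('n) - 1}"

definition nonexpansive_hyperplanes ::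
  "'a::metric_space set \<Rightarrow> (int ^ 'n \<Rightarrow> 'a \<Rightarrow> 'a) \<Rightarrow> (real ^ 'n) set set" where
  "nonexpansive_hyperplanes X \<beta> = {V \<in> hyperplanes. \<not> expansive_for X \<beta> V}"

definition half_spaces :: "(real ^ 'n) set set" where
  "half_spaces = {{x. x \<bullet> v \<le> 0} | v. norm v = 1}"

definition nonexpansive_half_spaces ::
  "'a::metric_space set \<Rightarrow> (int ^ 'n \<Rightarrow> 'a \<Rightarrow> 'a) \<Rightarrow> (real ^ 'n) set set" where
  "nonexpansive_half_spaces X \<beta> = {H \<in> half_spaces. \<not> expansive_for X \<beta> H}"

end

theory Submission imports Defs begin

text \<open>
  Write \<open>V = {x. x \<bullet> v = 0}\<close> with \<open>v\<close> a unit vector.  The two half-spaces bounded by \<open>V\<close> contain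
  \<open>V\<close>, and expansiveness passes to larger sets, so a nonexpansive half-space has a nonexpansive
  boundary.

  For the converse suppose that both half-spaces bounded by \<open>V\<close> are expansive.  By compactness
  (\<open>finite_coding\<close>), \<open>\<epsilon>\<close>-closeness of two orbits at a finite set of lattice points of a half-space
  already forces \<open>\<epsilon>\<close>-closeness at any prescribed lattice point outside it.  Translating this
  implication along the lattice gives \<open>half_space_propagation\<close>: closeness on a slab of some fixed
  width spreads, in the direction of \<open>v\<close>, to a slab that is one unit wider.  With both half-spaces
  expansive it spreads in both directions, so by induction two orbits that stay close on one
  sufficiently wide slab around \<open>V\<close> stay close everywhere, hence coincide.  Thus \<open>V\<close> is expansive.
\<close>

section \<open>Closeness of orbits over subsets of the lattice\<close>

lemma Zd_action_closed: "Zd_action X \<beta> \<Longrightarrow> x \<in> X \<Longrightarrow> \<beta> n x \<in> X"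
  unfolding Zd_action_def homeomorphism_def by (metis image_eqI)

lemma rho_on_le_iff:
  assumes "compact X" and act: "Zd_action X \<beta>" and "x \<in> X" "y \<in> X" and "0 \<le> \<epsilon>"
  shows "rho_on \<beta> F x y \<le> \<epsilon> \<longleftrightarrow>
         (\<forall>n. lattice_embed n \<in> F \<longrightarrow> dist (\<beta> n x) (\<beta> n y) \<le> \<epsilon>)"
proof (cases "{n. lattice_embed n \<in> F} = {}")
  case True
  then show ?thesis using assms(5) by (simp add: rho_on_def)
next
  case False
  obtain b where b: "\<And>p q. p \<in> X \<Longrightarrow> q \<in> X \<Longrightarrow> dist p q \<le> b"
    using compact_imp_bounded[OF assms(1)] by (auto simp: bounded_two_points)
  note inX = Zd_action_closed[OF act]
  have "bdd_above ((\<lambda>n. dist (\<beta> n x) (\<beta> n y)) ` {n. lattice_embed n \<in> F})"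
    using b inX assms(3,4) by (intro bdd_aboveI[where M = b]) auto
  from cSUP_le_iff[OF False this, of \<epsilon>] show ?thesis
    using False by (auto simp: rho_on_def)
qed

lemma expansive_for_iff:
  assumes "compact X" and "Zd_action X \<beta>"
  shows "expansive_for X \<beta> F \<longleftrightarrow>
    (\<exists>\<epsilon>>0. \<exists>t>0. \<forall>x\<in>X. \<forall>y\<in>X.
       (\<forall>n. lattice_embed n \<in> thicken F t \<longrightarrow> dist (\<beta> n x) (\<beta> n y) \<le> \<epsilon>) \<longrightarrow> x = y)"
proof -
  have "rho_on \<beta> (thicken F t) x y \<le> \<epsilon> \<longleftrightarrow>
      (\<forall>n. lattice_embed n \<in> thicken F t \<longrightarrow> dist (\<beta> n x) (\<beta> n y) \<le> \<epsilon>)"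
    if "0 < \<epsilon>" "x \<in> X" "y \<in> X" for \<epsilon> t x y
    using rho_on_le_iff[OF assms that(2,3)] that(1) by simp
  then show ?thesis unfolding expansive_for_def by (auto cong: conj_cong ball_cong)
qed

lemma thicken_mono:
  assumes "F \<subseteq> G" and "F \<noteq> {}"
  shows "thicken F t \<subseteq> thicken G t"
proof
  fix x assume "x \<in> thicken F t"
  then show "x \<in> thicken G t"
    using assms infdist_mono[OF assms, of x] by (auto simp: thicken_def)
qed

lemma expansive_for_superset:
  assumes "compact X" and "Zd_action X \<beta>" and "expansive_for X \<beta> F" and "F \<subseteq> G" and "F \<noteq> {}"
  shows "expansive_for X \<beta> G"
proof -
  from assms(3) obtain \<epsilon> t where e: "0 < \<epsilon>" "0 < t" and
    F: "\<forall>x\<in>X. \<forall>y\<in>X. (\<forall>n. lattice_embed n \<in> thicken F t \<longrightarrow>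
          dist (\<beta> n x) (\<beta> n y) \<le> \<epsilon>) \<longrightarrow> x = y"
    unfolding expansive_for_iff[OF assms(1,2)] by blast
  have "\<forall>x\<in>X. \<forall>y\<in>X. (\<forall>n. lattice_embed n \<in> thicken G t \<longrightarrow>
          dist (\<beta> n x) (\<beta> n y) \<le> \<epsilon>) \<longrightarrow> x = y"
    using F thicken_mono[OF assms(4,5), of t] by blast
  with e show ?thesis unfolding expansive_for_iff[OF assms(1,2)] by blast
qed

section \<open>Slabs and half-spaces\<close>

lemma thicken_half_space_subset:
  assumes "norm v = 1"
  shows "thicken {x. x \<bullet> v \<le> 0} t \<subseteq> {x. x \<bullet> v \<le> t}"
proof
  fix x assume x: "x \<in> thicken {x. x \<bullet> v \<le> 0} t"
  have "closed {x. x \<bullet> v \<le> 0}"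
    using closed_halfspace_le[of v 0] by (simp add: inner_commute)
  then obtain z where z: "z \<bullet> v \<le> 0" "infdist x {x. x \<bullet> v \<le> 0} = dist x z"
    using x infdist_attains_inf[of "{x. x \<bullet> v \<le> 0}" x] by (auto simp: thicken_def)
  have "(x - z) \<bullet> v \<le> norm (x - z) * norm v" by (rule norm_cauchy_schwarz)
  then show "x \<in> {x. x \<bullet> v \<le> t}"
    using x z assms by (simp add: thicken_def inner_diff_left dist_norm)
qed

lemma slab_subset_thicken_hyperplane:
  assumes "norm v = 1"
  shows "{x. \<bar>x \<bullet> v\<bar> \<le> t} \<subseteq> thicken {x. x \<bullet> v = 0} t"
proof
  fix x assume x: "x \<in> {x. \<bar>x \<bullet> v\<bar> \<le> t}"
  let ?z = "x - (x \<bullet> v) *\<^sub>R v"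
  have "v \<bullet> v = 1" using assms by (simp add: norm_eq_1)
  then have z: "?z \<in> {x. x \<bullet> v = 0}" by (simp add: inner_diff_left)
  have "dist x ?z \<le> t" using x assms by (simp add: dist_norm)
  then have "infdist x {x. x \<bullet> v = 0} \<le> t" using infdist_le2[OF z] by blast
  then show "x \<in> thicken {x. x \<bullet> v = 0} t" using z by (auto simp: thicken_def)
qed

lemma hyperplane_unit_normal:
  fixes V :: "(real ^ 'n) set"
  assumes "V \<in> hyperplanes"
  obtains v where "norm v = 1" "V = {x. x \<bullet> v = 0}"
proof -
  have V: "subspace V" "dim V = CARD('n) - 1" using assms by (auto simp: hyperplanes_def)
  have "dim V < DIM(real ^ 'n)" using V(2) by simp
  then obtain a where a: "a \<noteq> 0" "span V \<subseteq> {x. a \<bullet> x = 0}"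
    using lowdim_subset_hyperplane by metis
  have "V = {x. a \<bullet> x = 0}"
    by (rule subspace_dim_equal)
      (use V a dim_hyperplane[OF a(1)] span_superset[of V] in
        \<open>auto simp: subspace_hyperplane\<close>)
  then have "V = {x. x \<bullet> (a /\<^sub>R norm a) = 0}" using a(1) by (auto simp: inner_commute)
  moreover have "norm (a /\<^sub>R norm a) = 1" using a(1) by simp
  ultimately show ?thesis by (rule that[rotated])
qed

lemma frontier_half_space:
  assumes "norm v = 1"
  shows "frontier {x. x \<bullet> v \<le> 0} = {x. x \<bullet> v = 0}"
proof -
  have "v \<noteq> 0" using assms by auto
  then show ?thesis using frontier_halfspace_le[of v 0] by (simp add: inner_commute)
qed

lemma lattice_embed_add: "lattice_embed (m + n) = lattice_embed m + lattice_embed n"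
  by (simp add: lattice_embed_def vec_eq_iff)

text \<open>
  Since \<open>v \<noteq> 0\<close>, a large multiple of a suitably signed coordinate vector goes arbitrarily far in
  the direction of \<open>v\<close>.
\<close>
lemma lattice_unbounded_in_direction:
  assumes "v \<noteq> (0 :: real ^ 'n)"
  obtains k where "lattice_embed k \<bullet> v \<ge> r"
proof -
  obtain i where i: "v $ i \<noteq> 0" using assms by (auto simp: vec_eq_iff)
  define c where "c = (if v $ i > 0 then \<lceil>r / (v $ i)\<rceil> else \<lfloor>r / (v $ i)\<rfloor>)"
  have "lattice_embed (axis i c) = axis i (real_of_int c)"
    by (simp add: lattice_embed_def vec_eq_iff axis_def)
  then have e: "lattice_embed (axis i c) \<bullet> v = real_of_int c * v $ i"
    by (simp add: inner_axis')
  have "real_of_int c * v $ i \<ge> r"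
  proof (cases "v $ i > 0")
    case True
    then have "r / (v $ i) \<le> real_of_int c" by (simp add: c_def)
    then show ?thesis using True by (simp add: pos_divide_le_eq)
  next
    case False
    then have "real_of_int c \<le> r / (v $ i)" by (simp add: c_def)
    then show ?thesis using False i by (simp add: neg_le_divide_eq)
  qed
  with e that show ?thesis by metis
qed

section \<open>Propagation of closeness\<close>

text \<open>
  The pairs in \<open>X \<times> X\<close> that are at distance at least \<open>\<epsilon>\<close> at time \<open>k\<close> form a compact set.  It misses
  the intersection of the closed conditions imposed at the times in \<open>E\<close>, because that intersection
  is contained in the diagonal; hence finitely many of these conditions suffice.
\<close>
lemma finite_coding:
  fixes X :: "'a::metric_space set" and \<beta> :: "int ^ 'n \<Rightarrow> 'a \<Rightarrow> 'a"
  assumes "compact X" and act: "Zd_action X \<beta>" and "0 < \<epsilon>"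
    and E: "\<And>x y. x \<in> X \<Longrightarrow> y \<in> X \<Longrightarrow> (\<And>n. n \<in> E \<Longrightarrow> dist (\<beta> n x) (\<beta> n y) \<le> \<epsilon>) \<Longrightarrow> x = y"
  obtains F where "finite F" "F \<subseteq> E"
    "\<And>x y. x \<in> X \<Longrightarrow> y \<in> X \<Longrightarrow> (\<And>n. n \<in> F \<Longrightarrow> dist (\<beta> n x) (\<beta> n y) \<le> \<epsilon>) \<Longrightarrow>
       dist (\<beta> k x) (\<beta> k y) < \<epsilon>"
proof -
  define D where "D n p = dist (\<beta> n (fst p)) (\<beta> n (snd p))" for n p
  define K where "K = {p \<in> X \<times> X. \<epsilon> \<le> D k p}"
  define C where "C n = {p \<in> X \<times> X. D n p \<le> \<epsilon>}" for n
  have comp: "compact (X \<times> X)" using assms(1) by (rule compact_Times[OF _ assms(1)])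
  have cont: "continuous_on (X \<times> X) (D n)" for n
  proof -
    have b: "continuous_on X (\<beta> n)" using act by (auto simp: Zd_action_def homeomorphism_def)
    show ?thesis unfolding D_def
      by (intro continuous_on_dist continuous_on_compose2[OF b] continuous_on_fst
          continuous_on_snd continuous_on_id) auto
  qed
  have clC: "closed (C n)" for n
    using continuous_closed_preimage[OF cont compact_imp_closed[OF comp] closed_atMost, of n \<epsilon>]
    by (simp add: C_def Int_def vimage_def)
  have "closed K"
    using continuous_closed_preimage[OF cont compact_imp_closed[OF comp] closed_atLeast, of k \<epsilon>]
    by (simp add: K_def Int_def vimage_def)
  then have "compact (X \<times> X \<inter> K)" by (rule compact_Int_closed[OF comp])
  moreover have "X \<times> X \<inter> K = K" by (auto simp: K_def)
  ultimately have cK: "compact K" by simp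
  have "K \<inter> \<Inter> (C ` E) = {}"
  proof (rule ccontr)
    assume "K \<inter> \<Inter> (C ` E) \<noteq> {}"
    then obtain p where p: "p \<in> K" "\<And>n. n \<in> E \<Longrightarrow> p \<in> C n" by blast
    then have "fst p = snd p"
      by (intro E) (auto simp: K_def C_def D_def)
    with p(1) \<open>0 < \<epsilon>\<close> show False by (simp add: K_def D_def)
  qed
  then obtain F where F: "finite F" "F \<subseteq> E" "K \<inter> \<Inter> (C ` F) = {}"
    using compact_imp_fip_image[OF cK, of E C] clC by metis
  show ?thesis
  proof (rule that[OF F(1,2)])
    fix x y assume xy: "x \<in> X" "y \<in> X" "\<And>n. n \<in> F \<Longrightarrow> dist (\<beta> n x) (\<beta> n y) \<le> \<epsilon>"
    then have "(x, y) \<in> \<Inter> (C ` F)" by (auto simp: C_def D_def)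
    with F(3) have "(x, y) \<notin> K" by blast
    with xy(1,2) show "dist (\<beta> k x) (\<beta> k y) < \<epsilon>" by (auto simp: K_def D_def)
  qed
qed

text \<open>
  Let closeness on the points of height at most \<open>t\<close> (height meaning inner product with \<open>v\<close>)
  determine the orbit.  Fix a lattice point \<open>k\<close> of height at least \<open>t + 1\<close> and a finite set \<open>F\<close>
  of points of height at most \<open>t\<close> that controls the time \<open>k\<close>.  The translate of \<open>F\<close> by \<open>n - k\<close>
  controls the time \<open>n\<close>, and it lies at least one unit and at most \<open>c\<close> units below \<open>n\<close>, where \<open>c\<close>
  depends on \<open>F\<close> and \<open>k\<close> only.
\<close>
lemma half_space_propagation:
  fixes X :: "'a::metric_space set" and \<beta> :: "int ^ 'n \<Rightarrow> 'a \<Rightarrow> 'a"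
  assumes "compact X" and act: "Zd_action X \<beta>" and "0 < \<epsilon>" and "v \<noteq> 0"
    and H: "\<forall>x\<in>X. \<forall>y\<in>X.
      (\<forall>n. lattice_embed n \<bullet> v \<le> t \<longrightarrow> dist (\<beta> n x) (\<beta> n y) \<le> \<epsilon>) \<longrightarrow> x = y"
  shows "\<exists>c>0. \<forall>x\<in>X. \<forall>y\<in>X. \<forall>s.
      (\<forall>m. lattice_embed m \<bullet> v \<in> {s - c..s} \<longrightarrow> dist (\<beta> m x) (\<beta> m y) \<le> \<epsilon>) \<longrightarrow>
      (\<forall>n. lattice_embed n \<bullet> v \<in> {s - c..s + 1} \<longrightarrow> dist (\<beta> n x) (\<beta> n y) \<le> \<epsilon>)"
proof -
  obtain k where k: "lattice_embed k \<bullet> v \<ge> t + 1"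
    using lattice_unbounded_in_direction[OF \<open>v \<noteq> 0\<close>] by metis
  obtain F where F: "finite F" "F \<subseteq> {n. lattice_embed n \<bullet> v \<le> t}"
    "\<And>x y. x \<in> X \<Longrightarrow> y \<in> X \<Longrightarrow> (\<And>n. n \<in> F \<Longrightarrow> dist (\<beta> n x) (\<beta> n y) \<le> \<epsilon>) \<Longrightarrow>
       dist (\<beta> k x) (\<beta> k y) < \<epsilon>"
    by (rule finite_coding[OF assms(1) act \<open>0 < \<epsilon>\<close>,
          where E = "{n. lattice_embed n \<bullet> v \<le> t}" and k = k]) (use H in auto)
  obtain b where b: "\<And>m. m \<in> F \<Longrightarrow> lattice_embed k \<bullet> v - lattice_embed m \<bullet> v \<le> b"
    using bdd_above_finite[OF finite_imageI[OF F(1)],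
        of "\<lambda>m. lattice_embed k \<bullet> v - lattice_embed m \<bullet> v"]
    by (auto simp: bdd_above_def)
  note inX = Zd_action_closed[OF act]
  have add: "\<beta> (m + n) z = \<beta> m (\<beta> n z)" if "z \<in> X" for m n z
    using act that by (auto simp: Zd_action_def)
  \<comment> \<open>The maximum with 1 keeps the width positive when \<open>F\<close> is empty.\<close>
  show ?thesis
  proof (intro exI[of _ "max 1 b"] conjI ballI allI impI)
    fix x y s n
    assume xy: "x \<in> X" "y \<in> X"
      and "\<forall>m. lattice_embed m \<bullet> v \<in> {s - max 1 b..s} \<longrightarrow> dist (\<beta> m x) (\<beta> m y) \<le> \<epsilon>"
      and "lattice_embed n \<bullet> v \<in> {s - max 1 b..s + 1}"
    then have near: "\<And>m. s - max 1 b \<le> lattice_embed m \<bullet> v \<Longrightarrow> lattice_embed m \<bullet> v \<le> s \<Longrightarrow>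
        dist (\<beta> m x) (\<beta> m y) \<le> \<epsilon>"
      and n: "s - max 1 b \<le> lattice_embed n \<bullet> v" "lattice_embed n \<bullet> v \<le> s + 1"
      by auto
    show "dist (\<beta> n x) (\<beta> n y) \<le> \<epsilon>"
    proof (cases "lattice_embed n \<bullet> v \<le> s")
      case True
      then show ?thesis using near n by blast
    next
      case False
      have nk: "lattice_embed (n - k) \<bullet> v = lattice_embed n \<bullet> v - lattice_embed k \<bullet> v"
        using lattice_embed_add[of "n - k" k] by (simp add: inner_add_left)
      have "dist (\<beta> k (\<beta> (n - k) x)) (\<beta> k (\<beta> (n - k) y)) < \<epsilon>"
      proof (rule F(3))
        fix m assume m: "m \<in> F"
        have "lattice_embed m \<bullet> v \<le> t" using F(2) m by auto
        with b[OF m] k n False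
        have "dist (\<beta> (m + (n - k)) x) (\<beta> (m + (n - k)) y) \<le> \<epsilon>"
          by (intro near) (simp_all add: lattice_embed_add inner_add_left nk)
        then show "dist (\<beta> m (\<beta> (n - k) x)) (\<beta> m (\<beta> (n - k) y)) \<le> \<epsilon>"
          using xy by (simp only: add)
      qed (use xy inX in auto)
      then show ?thesis using xy by (simp flip: add)
    qed
  qed simp
qed

lemma expansive_half_space_determines:
  assumes "compact X" and "Zd_action X \<beta>" and "norm v = 1"
    and "expansive_for X \<beta> {x. x \<bullet> v \<le> 0}"
  shows "\<exists>\<epsilon>>0. \<exists>t. \<forall>x\<in>X. \<forall>y\<in>X.
      (\<forall>n. lattice_embed n \<bullet> v \<le> t \<longrightarrow> dist (\<beta> n x) (\<beta> n y) \<le> \<epsilon>) \<longrightarrow> x = y"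
proof -
  from assms(4) obtain \<epsilon> t where "0 < \<epsilon>" and
    "\<forall>x\<in>X. \<forall>y\<in>X. (\<forall>n. lattice_embed n \<in> thicken {x. x \<bullet> v \<le> 0} t \<longrightarrow>
          dist (\<beta> n x) (\<beta> n y) \<le> \<epsilon>) \<longrightarrow> x = y"
    unfolding expansive_for_iff[OF assms(1,2)] by blast
  then show ?thesis using thicken_half_space_subset[OF assms(3), of t] by blast
qed

text \<open>
  Both half-spaces push closeness out of a slab by one unit, one upwards and the other downwards,
  as soon as the slab is as wide as both propagation lemmas demand.  Iterating reaches every
  lattice point.
\<close>
lemma expansive_hyperplane_if_both_sides:
  fixes X :: "'a::metric_space set" and \<beta> :: "int ^ 'n \<Rightarrow> 'a \<Rightarrow> 'a"
  assumes X: "compact X" and act: "Zd_action X \<beta>" and v: "norm v = 1"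
    and up: "expansive_for X \<beta> {x. x \<bullet> v \<le> 0}"
    and down: "expansive_for X \<beta> {x. x \<bullet> (- v) \<le> 0}"
  shows "expansive_for X \<beta> {x. x \<bullet> v = 0}"
proof -
  have v': "norm (- v) = 1" and v0: "v \<noteq> 0" "- v \<noteq> 0" using v by auto
  obtain \<epsilon>1 t1 where 1: "0 < \<epsilon>1" "\<forall>x\<in>X. \<forall>y\<in>X.
      (\<forall>n. lattice_embed n \<bullet> v \<le> t1 \<longrightarrow> dist (\<beta> n x) (\<beta> n y) \<le> \<epsilon>1) \<longrightarrow> x = y"
    using expansive_half_space_determines[OF X act v up] by blast
  obtain \<epsilon>2 t2 where 2: "0 < \<epsilon>2" "\<forall>x\<in>X. \<forall>y\<in>X.
      (\<forall>n. lattice_embed n \<bullet> (- v) \<le> t2 \<longrightarrow> dist (\<beta> n x) (\<beta> n y) \<le> \<epsilon>2) \<longrightarrow> x = y"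
    using expansive_half_space_determines[OF X act v' down] by blast
  \<comment> \<open>Each side feeds on closeness produced by the other, so both must use the same bound.\<close>
  define \<epsilon> where "\<epsilon> = min \<epsilon>1 \<epsilon>2"
  have e: "0 < \<epsilon>" "\<epsilon> \<le> \<epsilon>1" "\<epsilon> \<le> \<epsilon>2" using 1(1) 2(1) by (auto simp: \<epsilon>_def)
  have below: "\<forall>x\<in>X. \<forall>y\<in>X.
      (\<forall>n. lattice_embed n \<bullet> v \<le> t1 \<longrightarrow> dist (\<beta> n x) (\<beta> n y) \<le> \<epsilon>) \<longrightarrow> x = y"
    using 1(2) order_trans[OF _ e(2)] by blast
  have above: "\<forall>x\<in>X. \<forall>y\<in>X.
      (\<forall>n. lattice_embed n \<bullet> (- v) \<le> t2 \<longrightarrow> dist (\<beta> n x) (\<beta> n y) \<le> \<epsilon>) \<longrightarrow> x = y"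
    using 2(2) order_trans[OF _ e(3)] by blast
  obtain c1 where c1: "0 < c1" "\<forall>x\<in>X. \<forall>y\<in>X. \<forall>s.
      (\<forall>m. lattice_embed m \<bullet> v \<in> {s - c1..s} \<longrightarrow> dist (\<beta> m x) (\<beta> m y) \<le> \<epsilon>) \<longrightarrow>
      (\<forall>n. lattice_embed n \<bullet> v \<in> {s - c1..s + 1} \<longrightarrow> dist (\<beta> n x) (\<beta> n y) \<le> \<epsilon>)"
    using half_space_propagation[OF X act e(1) v0(1) below] by blast
  obtain c2 where c2: "0 < c2" "\<forall>x\<in>X. \<forall>y\<in>X. \<forall>s.
      (\<forall>m. lattice_embed m \<bullet> (- v) \<in> {s - c2..s} \<longrightarrow> dist (\<beta> m x) (\<beta> m y) \<le> \<epsilon>) \<longrightarrow>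
      (\<forall>n. lattice_embed n \<bullet> (- v) \<in> {s - c2..s + 1} \<longrightarrow> dist (\<beta> n x) (\<beta> n y) \<le> \<epsilon>)"
    using half_space_propagation[OF X act e(1) v0(2) above] by blast
  define c where "c = max c1 c2"
  have c: "0 < c" "c1 \<le> c" "c2 \<le> c" using c1(1) by (auto simp: c_def)
  have spread: "dist (\<beta> n x) (\<beta> n y) \<le> \<epsilon>"
    if xy: "x \<in> X" "y \<in> X"
      and slab: "\<And>m. \<bar>lattice_embed m \<bullet> v\<bar> \<le> c \<Longrightarrow> dist (\<beta> m x) (\<beta> m y) \<le> \<epsilon>"
      and n: "\<bar>lattice_embed n \<bullet> v\<bar> \<le> c + real j" for x y n j
    using n
  proof (induction j arbitrary: n)
    case 0
    then show ?case using slab by simp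
  next
    case (Suc j)
    consider "\<bar>lattice_embed n \<bullet> v\<bar> \<le> c + real j" | "c + real j < lattice_embed n \<bullet> v"
      | "lattice_embed n \<bullet> v < - (c + real j)" by linarith
    then show ?case
    proof cases
      case 1
      then show ?thesis by (rule Suc.IH)
    next
      case 2
      show ?thesis
        by (rule c1(2)[rule_format, OF xy, of "c + real j"])
          (use Suc.prems 2 c c1(1) in \<open>auto intro!: Suc.IH simp: abs_le_iff\<close>)
    next
      case 3
      show ?thesis
        by (rule c2(2)[rule_format, OF xy, of "c + real j"])
          (use Suc.prems 3 c c2(1) in \<open>auto intro!: Suc.IH simp: abs_le_iff\<close>)
    qed
  qed
  have "x = y"
    if xy: "x \<in> X" "y \<in> X"
      and near: "\<And>n. lattice_embed n \<in> thicken {x. x \<bullet> v = 0} c \<Longrightarrow>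
        dist (\<beta> n x) (\<beta> n y) \<le> \<epsilon>" for x y
  proof (rule below[rule_format, OF xy])
    fix n
    have slab: "dist (\<beta> m x) (\<beta> m y) \<le> \<epsilon>" if "\<bar>lattice_embed m \<bullet> v\<bar> \<le> c" for m
      using near slab_subset_thicken_hyperplane[OF v, of c] that by blast
    obtain j where "\<bar>lattice_embed n \<bullet> v\<bar> \<le> real j" using real_arch_simple by blast
    then have "\<bar>lattice_embed n \<bullet> v\<bar> \<le> c + real j" using c(1) by linarith
    with spread[OF xy slab] show "dist (\<beta> n x) (\<beta> n y) \<le> \<epsilon>" by blast
  qed
  then show ?thesis
    unfolding expansive_for_iff[OF X act] using e(1) c(1) by blast
qed

theorem lemma2p9:
  fixes X :: "'a::metric_space set"
    and \<beta> :: "int ^ 'n \<Rightarrow> 'a \<Rightarrow> 'a"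
    and V :: "(real ^ 'n) set"
  assumes "compact X" and "infinite X"
    and "Zd_action X \<beta>"
    and "V \<in> hyperplanes"
  shows "V \<in> nonexpansive_hyperplanes X \<beta> \<longleftrightarrow>
         (\<exists>H \<in> nonexpansive_half_spaces X \<beta>. frontier H = V)"
proof
  obtain v where v: "norm v = 1" "V = {x. x \<bullet> v = 0}"
    using hyperplane_unit_normal[OF assms(4)] .
  have v': "norm (- v) = 1" using v(1) by simp
  assume "V \<in> nonexpansive_hyperplanes X \<beta>"
  then have "\<not> expansive_for X \<beta> {x. x \<bullet> v = 0}"
    using v(2) by (simp add: nonexpansive_hyperplanes_def)
  then have "\<exists>w \<in> {v, - v}. \<not> expansive_for X \<beta> {x. x \<bullet> w \<le> 0}"
    using expansive_hyperplane_if_both_sides[OF assms(1,3) v(1)] by blast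
  then obtain w where w: "w \<in> {v, - v}" "\<not> expansive_for X \<beta> {x. x \<bullet> w \<le> 0}" by blast
  have w1: "norm w = 1" using w(1) v(1) v' by blast
  have "{x. x \<bullet> w = 0} = {x. x \<bullet> v = 0}" using w(1) by auto
  then have "frontier {x. x \<bullet> w \<le> 0} = V"
    using frontier_half_space[OF w1] v(2) by simp
  moreover have "{x. x \<bullet> w \<le> 0} \<in> nonexpansive_half_spaces X \<beta>"
    using w(2) w1 by (auto simp: nonexpansive_half_spaces_def half_spaces_def)
  ultimately show "\<exists>H \<in> nonexpansive_half_spaces X \<beta>. frontier H = V" by blast
next
  assume "\<exists>H \<in> nonexpansive_half_spaces X \<beta>. frontier H = V"
  then obtain w where w: "norm w = 1" "\<not> expansive_for X \<beta> {x. x \<bullet> w \<le> 0}"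
    "frontier {x. x \<bullet> w \<le> 0} = V"
    by (auto simp: nonexpansive_half_spaces_def half_spaces_def)
  have "V = {x. x \<bullet> w = 0}" using w(3) frontier_half_space[OF w(1)] by simp
  then have "V \<subseteq> {x. x \<bullet> w \<le> 0}" and "0 \<in> V" by auto
  then have "\<not> expansive_for X \<beta> V"
    using expansive_for_superset[OF assms(1,3)] w(2) by blast
  then show "V \<in> nonexpansive_hyperplanes X \<beta>"
    using assms(4) by (simp add: nonexpansive_hyperplanes_def)
qed

end
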